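(* Let $q_r=1$ and $q_a\in[1,2]$, and let $\omega$ be a non-negative measure on $\mathbb{R}$ with bounded, compactly supported density and total mass $m=\omega(\mathbb{R})>0$. Assume that either $q_a>1$, or that $q_a=1$ and $m\ge1$. Then there are real numbers $\underline x<x_0<\overline x$ (unique, if $q_a>1$) such that $$(\psi_a'\ast\omega)(x_0)=0,\qquad(\psi_a'\ast\omega)(\underline x)=-1,\qquad(\psi_a'\ast\omega)(\overline x)=1,$$ and there is a unique steady state, which is given by $$\mu^\star=\tfrac12\,(\psi_a''\ast\omega)\,\mathbf{1}_{[\underline x,\overline x]}.$$ If instead $q_a=1$ and $m<1$, then there is no steady state.
   Context: $L^\infty_c(\mathbb{R})$ denotes essentially bounded functions with compact support; $\mathcal{P}(\mathbb{R})$ the probability measures on $\mathbb{R}$. Absolutely continuous measures are identified with their densities. For a finite non-negative measure $\nu$ on $\mathbb{R}$ let $F_\nu(x)=\nu((-\infty,x])$ be its CDF and $X_\nu:[0,\nu(\mathbb{R}))\to\mathbb{R}$, $X_\nu(z)=\inf\{x\in\mathbb{R}:F_\nu(x)>z\}$ its pseudo-inverse (inverse distribution function). Let $\psi_a(x)=|x|^{q_a}$, $\psi_r(x)=|x|^{q_r}$ with $q_a,q_r\in[1,2]$, and put $G=F_\omega$, $Y=X_\omega$. For $q_a=1$ one has $\psi_a'=\operatorname{sgn}$, so $\psi_a'\ast\omega=2G-m$, and $\psi_a''=2\delta_0$, so $\frac12\psi_a''\ast\omega=\omega$. For $q_a>1$, $\psi_a''(x)=q_a(q_a-1)|x|^{q_a-2}$.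 Here $(f\ast\omega)(x)=\int_{\mathbb{R}}f(x-y)\,d\omega(y)$. Steady state: a probability measure $\mu^\star\in\mathcal{P}(\mathbb{R})$ with density in $L^\infty_c(\mathbb{R})$ whose pseudo-inverse $X^\star=X_{\mu^\star}$ satisfies $A(z)=R(z)$ at every $z\in[0,1)$, where $A(z)=\int_0^m\psi_a'(X^\star(z)-Y(\zeta))\,d\zeta$ if $q_a>1$ and $A(z)=2G(X^\star(z))-m$ if $q_a=1$; and $R(z)=\int_0^1\psi_r'(X^\star(z)-X^\star(\zeta))\,d\zeta$ if $q_r>1$ and $R(z)=2z-1$ if $q_r=1$. *)

theory Defs
  imports "HOL-Probability.Probability"
begin

section \<open>Measures and inverse distribution functions\<close>

definition has_Linf_c_density :: "real measure \<Rightarrow> bool" where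
  "has_Linf_c_density M \<longleftrightarrow>
     (\<exists>w \<in> borel_measurable borel.
        (\<forall>x. 0 \<le> w x) \<and>
        (\<exists>C::real. AE x in lborel. w x \<le> C) \<and>
        (\<exists>K. compact K \<and> (AE x in lborel. x \<notin> K \<longrightarrow> w x = 0)) \<and>
        M = density lborel (\<lambda>x. ennreal (w x)))"

definition mass :: "real measure \<Rightarrow> real" where
  "mass M = measure M UNIV"

text \<open>
  Meaningful for \<open>0 \<le> z < mass M\<close>; then the set is nonempty, and it is bounded below if
  \<open>z > 0\<close> or if \<open>M\<close> has compact support.
\<close>

definition inv_cdf :: "real measure \<Rightarrow> real \<Rightarrow> real" where
  "inv_cdf M z = Inf {x. cdf M x > z}"

definition conv_fun :: "(real \<Rightarrow> real) \<Rightarrow> real measure \<Rightarrow> real \<Rightarrow> real" where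
  "conv_fun f M x = (LINT y|M. f (x - y))"

section \<open>The power potentials\<close>

definition psi :: "real \<Rightarrow> real \<Rightarrow> real" where
  "psi q x = \<bar>x\<bar> powr q"

definition dpsi :: "real \<Rightarrow> real \<Rightarrow> real" where
  "dpsi q x = q * sgn x * \<bar>x\<bar> powr (q - 1)"

text \<open>
  For \<open>q > 1\<close> only. The value at \<open>0\<close> (which is \<open>0\<close> here, as \<open>0 powr a = 0\<close>) is immaterial:
  the function is only convolved with measures that have no atoms.
\<close>

definition ddpsi :: "real \<Rightarrow> real \<Rightarrow> real" where
  "ddpsi q x = q * (q - 1) * \<bar>x\<bar> powr (q - 2)"

lemma dpsi_1: "dpsi 1 = sgn"
  by (rule ext) (simp add: dpsi_def sgn_real_def)

lemma has_real_derivative_psi_nonzero: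
  assumes "x \<noteq> 0"
  shows "(psi q has_real_derivative dpsi q x) (at x)"
proof -
  have "((\<lambda>x. (sgn a * x) powr q) has_real_derivative dpsi q x) (at x)" if "a = x" for a
    using assms that
    by (auto intro!: derivative_eq_intros simp: dpsi_def sgn_real_def split: if_splits)
  then have "((\<lambda>y. (sgn x * y) powr q) has_real_derivative dpsi q x) (at x)"
    by simp
  moreover have "open {y. sgn y = sgn x}"
  proof (cases "x > 0")
    case True
    then have "{y. sgn y = sgn x} = {0<..}" by (auto simp: sgn_real_def split: if_splits)
    then show ?thesis by simp
  next
    case False
    then have "{y. sgn y = sgn x} = {..<0}"
      using assms by (auto simp: sgn_real_def split: if_splits)
    then show ?thesis by simp
  qed
  ultimately show ?thesis
    by (rule has_field_derivative_transform_within_open)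
       (auto simp: psi_def abs_sgn mult.commute)
qed

lemma has_real_derivative_psi:
  assumes "q > 1"
  shows "(psi q has_real_derivative dpsi q x) (at x)"
proof (cases "x = 0")
  case True
  have "((\<lambda>h. \<bar>h\<bar> powr (q - 1)) \<longlongrightarrow> \<bar>0\<bar> powr (q - 1)) (at (0::real))"
    using assms by (intro tendsto_intros) auto
  then have "((\<lambda>h. \<bar>h\<bar> powr (q - 1)) \<longlongrightarrow> 0) (at (0::real))"
    by simp
  then have "((\<lambda>h. psi q h / h) \<longlongrightarrow> 0) (at 0)"
  proof (rule Lim_null_comparison[rotated])
    have "norm (psi q h / h) \<le> \<bar>h\<bar> powr (q - 1)" for h
      by (cases "h = 0") (auto simp: psi_def powr_diff abs_div)
    then show "eventually (\<lambda>h. norm (psi q h / h) \<le> \<bar>h\<bar> powr (q - 1)) (at 0)"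
      by simp
  qed
  then show ?thesis
    using True by (simp add: has_field_derivative_iff dpsi_def psi_def)
qed (rule has_real_derivative_psi_nonzero)

lemma has_real_derivative_dpsi:
  assumes "x \<noteq> 0"
  shows "(dpsi q has_real_derivative ddpsi q x) (at x)"
proof -
  have "((\<lambda>y. q * sgn x * psi (q - 1) y) has_real_derivative q * sgn x * dpsi (q - 1) x) (at x)"
    by (intro DERIV_cmult has_real_derivative_psi_nonzero assms)
  moreover have "q * sgn x * dpsi (q - 1) x = ddpsi q x"
    using assms by (auto simp: dpsi_def ddpsi_def sgn_real_def)
  ultimately have "((\<lambda>y. q * sgn x * psi (q - 1) y) has_real_derivative ddpsi q x) (at x)"
    by simp
  moreover have "open (if x > 0 then {0<..} else {..<0::real})" by simp
  ultimately show ?thesis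
    by (rule has_field_derivative_transform_within_open)
       (use assms in \<open>auto simp: psi_def dpsi_def sgn_real_def split: if_splits\<close>)
qed

text \<open>
  The measure \<open>\<psi>'' * \<omega>\<close>: for \<open>q = 1\<close> the distributional second derivative is twice the Dirac
  measure at \<open>0\<close>, convolved as a measure; for \<open>q > 1\<close> the function \<open>\<psi>'' * \<omega>\<close> is
  identified with the measure having it as density.
\<close>

definition ddpsi_conv :: "real \<Rightarrow> real measure \<Rightarrow> real measure" where
  "ddpsi_conv q \<omega> =
     (if q = 1 then convolution (scale_measure 2 (return borel 0)) \<omega>
      else density lborel (\<lambda>x. ennreal (conv_fun (ddpsi q) \<omega> x)))"

lemma ddpsi_conv_1:
  assumes "finite_measure \<omega>" "sets \<omega> = sets borel"
  shows "ddpsi_conv 1 \<omega> = scale_measure 2 \<omega>"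
proof (rule measure_eqI)
  show "sets (ddpsi_conv 1 \<omega>) = sets (scale_measure 2 \<omega>)"
    using assms by (simp add: ddpsi_conv_def)
next
  fix A assume "A \<in> sets (ddpsi_conv 1 \<omega>)"
  then have A: "A \<in> sets borel" by (simp add: ddpsi_conv_def)
  have fin: "finite_measure (scale_measure 2 (return borel (0::real)))"
    by (rule finite_measureI) (simp add: space_scale_measure ennreal_mult_eq_top_iff)
  have [measurable]: "(\<lambda>x. \<integral>\<^sup>+y. indicator A (x + y) \<partial>\<omega>) \<in> borel_measurable (borel :: real measure)"
  proof -
    interpret finite_measure \<omega> by fact
    note [measurable_cong] = assms(2)
    note A [measurable]
    show ?thesis by measurable
  qed
  have "emeasure (ddpsi_conv 1 \<omega>) A =
      (\<integral>\<^sup>+x. indicator A x \<partial>convolution (scale_measure 2 (return borel 0)) \<omega>)"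
    using A by (simp add: ddpsi_conv_def)
  also have "\<dots> = (\<integral>\<^sup>+x. \<integral>\<^sup>+y. indicator A (x + y) \<partial>\<omega> \<partial>scale_measure 2 (return borel 0))"
    using A assms fin by (intro nn_integral_convolution) auto
  also have "\<dots> = 2 * (\<integral>\<^sup>+x. \<integral>\<^sup>+y. indicator A (x + y) \<partial>\<omega> \<partial>return borel 0)"
    by (rule nn_integral_scale_measure) simp
  also have "\<dots> = 2 * (\<integral>\<^sup>+y. indicator A (0 + y) \<partial>\<omega>)"
    by (subst nn_integral_return) auto
  finally show "emeasure (ddpsi_conv 1 \<omega>) A = emeasure (scale_measure 2 \<omega>) A"
    using A assms by simp
qed

section \<open>Steady states\<close>

definition attraction :: "real \<Rightarrow> real measure \<Rightarrow> real measure \<Rightarrow> real \<Rightarrow> real" where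
  "attraction q\<^sub>a \<omega> \<mu> z =
     (if q\<^sub>a = 1 then 2 * cdf \<omega> (inv_cdf \<mu> z) - mass \<omega>
      else (LINT \<zeta>:{0..<mass \<omega>}|lborel. dpsi q\<^sub>a (inv_cdf \<mu> z - inv_cdf \<omega> \<zeta>)))"

definition repulsion :: "real \<Rightarrow> real measure \<Rightarrow> real \<Rightarrow> real" where
  "repulsion q\<^sub>r \<mu> z =
     (if q\<^sub>r = 1 then 2 * z - 1
      else (LINT \<zeta>:{0..<1}|lborel. dpsi q\<^sub>r (inv_cdf \<mu> z - inv_cdf \<mu> \<zeta>)))"

definition steady_state :: "real \<Rightarrow> real \<Rightarrow> real measure \<Rightarrow> real measure \<Rightarrow> bool" where
  "steady_state q\<^sub>a q\<^sub>r \<omega> \<mu> \<longleftrightarrow>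
     prob_space \<mu> \<and> has_Linf_c_density \<mu> \<and>
     (\<forall>z\<in>{0..<1}. attraction q\<^sub>a \<omega> \<mu> z = repulsion q\<^sub>r \<mu> z)"

end

theory Submission
  imports Defs
begin

text \<open>
  Let \<open>H = \<psi>\<^sub>a' * \<omega>\<close>, a continuous nondecreasing function. The inverse distribution function of
  \<open>\<omega>\<close> pushes Lebesgue measure on \<open>[0, m)\<close> forward to \<open>\<omega>\<close>, so the steady state condition reads
  \<open>H (X z) = 2 z - 1\<close> for all \<open>z \<in> [0, 1)\<close>. This is equivalent to the distribution function of \<open>\<mu>\<close>
  being \<open>(1 + H) / 2\<close> truncated to \<open>[0, 1]\<close>, which determines \<open>\<mu>\<close>. By Tonelli and the fundamental
  theorem of calculus, \<open>\<psi>\<^sub>a'' * \<omega>\<close> gives \<open>[a, b]\<close> the mass \<open>H b - H a\<close>, so half of its restriction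
  to \<open>[xl, xr]\<close> has exactly that distribution function. For \<open>q\<^sub>a = 1\<close> and \<open>m < 1\<close> the condition fails
  at \<open>z = 0\<close>, since \<open>H \<ge> - m > - 1\<close>.
\<close>

section \<open>Monotonicity, continuity and integrals of psi' and psi''\<close>

lemma dpsi_minus: "dpsi q (- x) = - dpsi q x"
  by (simp add: dpsi_def sgn_minus)

lemma dpsi_zero [simp]: "dpsi q 0 = 0"
  by (simp add: dpsi_def)

lemma dpsi_strict_mono:
  assumes "q > 1" "x < y"
  shows "dpsi q x < dpsi q y"
proof -
  have pos: "dpsi q s < dpsi q t" if "0 \<le> s" "s < t" for s t
    using that assms(1) by (cases "s = 0") (auto simp: dpsi_def intro!: powr_less_mono2)
  consider "0 \<le> x" | "y \<le> 0" | "x < 0" "0 < y" by linarith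
  then show ?thesis
  proof cases
    case 1
    then show ?thesis using pos assms by blast
  next
    case 2
    then show ?thesis using pos[of "- y" "- x"] assms by (simp add: dpsi_minus)
  next
    case 3
    then show ?thesis using pos[of 0 "- x"] pos[of 0 y] by (simp add: dpsi_minus)
  qed
qed

lemma dpsi_mono:
  assumes "q \<ge> 1" "x \<le> y"
  shows "dpsi q x \<le> dpsi q y"
proof (cases "q = 1")
  case True
  then show ?thesis using assms by (auto simp: dpsi_1 sgn_real_def)
next
  case False
  then show ?thesis
    using dpsi_strict_mono[of q x y] assms by (cases "x = y") auto
qed

lemma abs_dpsi_le:
  assumes "q \<ge> 1" "\<bar>x\<bar> \<le> b"
  shows "\<bar>dpsi q x\<bar> \<le> dpsi q b"
  using dpsi_mono[of q x b] dpsi_mono[of q "- b" x] assms by (simp add: dpsi_minus abs_le_iff)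

lemma borel_measurable_dpsi [measurable]: "dpsi q \<in> borel_measurable borel"
  unfolding dpsi_def by measurable

lemma borel_measurable_ddpsi [measurable]: "ddpsi q \<in> borel_measurable borel"
  unfolding ddpsi_def by measurable

text \<open>For q = 1 the function is \<open>sgn\<close>, whose only jump is at 0. For q > 1 the
  point 0 needs its own argument, since the power with exponent q - 1 need not be differentiable
  there.\<close>

lemma isCont_dpsi:
  assumes "q \<ge> 1" "q > 1 \<or> x \<noteq> 0"
  shows "isCont (dpsi q) x"
proof (cases "x = 0")
  case False
  then show ?thesis using has_real_derivative_dpsi DERIV_isCont by blast
next
  case True
  with assms have q: "q > 1" by simp
  have "((\<lambda>h. q * \<bar>h\<bar> powr (q - 1)) \<longlongrightarrow> q * \<bar>0\<bar> powr (q - 1)) (at (0::real))"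
    using q by (intro tendsto_intros) auto
  then have "((\<lambda>h. q * \<bar>h\<bar> powr (q - 1)) \<longlongrightarrow> 0) (at (0::real))"
    by simp
  then have "(dpsi q \<longlongrightarrow> 0) (at 0)"
    by (rule Lim_null_comparison[rotated])
       (use q in \<open>auto simp: dpsi_def abs_mult sgn_real_def intro!: always_eventually\<close>)
  then show ?thesis using True by (simp add: isCont_def)
qed

lemma ddpsi_nonneg: "q \<ge> 1 \<Longrightarrow> 0 \<le> ddpsi q x"
  by (simp add: ddpsi_def)

text \<open>The exponent q - 2 is nonpositive. This controls psi'' away from its possible
  singularity at 0.\<close>

lemma ddpsi_le:
  assumes "q \<in> {1..2}" "\<bar>x\<bar> \<ge> 1"
  shows "ddpsi q x \<le> q * (q - 1)"
proof -
  have "\<bar>x\<bar> powr (q - 2) \<le> \<bar>x\<bar> powr 0"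
    using assms by (intro powr_mono) auto
  moreover have "\<bar>x\<bar> powr 0 = 1" using assms by auto
  ultimately have "\<bar>x\<bar> powr (q - 2) \<le> 1" by linarith
  then show ?thesis
    using assms mult_left_mono[of "\<bar>x\<bar> powr (q - 2)" 1 "q * (q - 1)"] by (simp add: ddpsi_def)
qed

text \<open>For q < 2 the integrand is singular at t = y. The fundamental theorem still applies,
  because psi' is continuous there and one exceptional point is allowed.\<close>

lemma nn_integral_ddpsi:
  assumes "q > 1" "a \<le> b"
  shows "(\<integral>\<^sup>+t. ennreal (ddpsi q (t - y)) * indicator {a..b} t \<partial>lborel) =
    ennreal (dpsi q (b - y) - dpsi q (a - y))"
proof -
  have "((\<lambda>t. ddpsi q (t - y)) has_integral (dpsi q (b - y) - dpsi q (a - y))) {a..b}"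
  proof (rule fundamental_theorem_of_calculus_interior_strong)
    show "finite {y}" "a \<le> b" using assms by auto
  next
    fix x assume "x \<in> {a<..<b} - {y}"
    then have "(dpsi q has_real_derivative ddpsi q (x - y)) (at (x - y))"
      by (intro has_real_derivative_dpsi) auto
    then have "((\<lambda>t. dpsi q (t - y)) has_real_derivative ddpsi q (x - y)) (at x)"
      using DERIV_shift[of "dpsi q" "ddpsi q (x - y)" x "- y"] by simp
    then show "((\<lambda>t. dpsi q (t - y)) has_vector_derivative ddpsi q (x - y)) (at x)"
      by (simp add: has_real_derivative_iff_has_vector_derivative)
  next
    show "continuous_on {a..b} (\<lambda>t. dpsi q (t - y))"
      using assms
      by (auto intro!: continuous_at_imp_continuous_on isCont_o2[where g = "dpsi q"] isCont_dpsi)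
  qed
  then have "((\<lambda>t. ddpsi q (t - y) * indicator {a..b} t) has_integral
      (dpsi q (b - y) - dpsi q (a - y))) UNIV"
    by (subst (asm) has_integral_restrict_UNIV[symmetric])
       (auto elim!: has_integral_eq[rotated] simp: indicator_def)
  then have "(\<integral>\<^sup>+t. ennreal (ddpsi q (t - y) * indicator {a..b} t) \<partial>lborel) =
      ennreal (dpsi q (b - y) - dpsi q (a - y))"
    using assms by (intro nn_integral_has_integral_lborel) (auto simp: ddpsi_nonneg)
  then show ?thesis
    by (simp add: ennreal_mult'' ennreal_indicator)
qed

section \<open>Distribution functions obtained by clamping a monotone function\<close>

lemma compact_abs_bound:
  fixes K :: "real set"
  assumes "compact K"
  obtains k where "0 \<le> k" "\<And>x. x \<in> K \<Longrightarrow> \<bar>x\<bar> \<le> k"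
  using compact_imp_bounded[OF assms] unfolding bounded_iff real_norm_def
  by (metis abs_ge_zero linear order_trans)

text \<open>Write F for the cdf and X for its pseudo-inverse. Forward: x <= X (F x) bounds H x from
  above, and X z <= x for z < F x bounds it from below. Backward: continuity makes H take the value
  2 z - 1 at the infimum of the points where it exceeds that value. The point k with F k = 0 keeps X
  z a genuine infimum even at z = 0.\<close>

lemma cdf_eq_clamp_iff:
  fixes H :: "real \<Rightarrow> real"
  assumes "real_distribution \<mu>" and low: "cdf \<mu> k = 0"
    and H: "mono H" "continuous_on UNIV H" and ends: "H xl = -1" "H xr = 1"
  shows "(\<forall>z\<in>{0..<1}. H (inv_cdf \<mu> z) = 2 * z - 1) \<longleftrightarrow>
    (\<forall>x. cdf \<mu> x = max 0 (min 1 ((1 + H x) / 2)))"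
proof safe
  interpret real_distribution \<mu> by fact
  have bdd: "bdd_below {x. cdf \<mu> x > z}" if "z \<ge> 0" for z
  proof (rule bdd_belowI)
    fix x assume "x \<in> {x. cdf \<mu> x > z}"
    then show "k \<le> x" using cdf_nondecreasing[of x k] low that by (cases "x \<le> k") auto
  qed
  have ne: "{x. cdf \<mu> x > z} \<noteq> {}" if "z < 1" for z
    using order_tendstoD(1)[OF cdf_lim_at_top_prob that] by (auto simp: eventually_at_top_linorder)
  fix x assume eq: "\<forall>z\<in>{0..<1}. H (inv_cdf \<mu> z) = 2 * z - 1"
  have up: "H x \<le> 2 * cdf \<mu> x - 1" if "cdf \<mu> x < 1"
  proof -
    have "x \<le> y" if "cdf \<mu> x < cdf \<mu> y" for y
      using cdf_nondecreasing[of y x] that by (cases "x \<le> y") auto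
    then have "x \<le> inv_cdf \<mu> (cdf \<mu> x)"
      unfolding inv_cdf_def by (intro cInf_greatest[OF ne[OF that]]) auto
    then have "H x \<le> H (inv_cdf \<mu> (cdf \<mu> x))" using H by (simp add: mono_def)
    then show ?thesis using eq that by (simp add: cdf_nonneg)
  qed
  \<comment> \<open>F need not exceed z at x for z = F x, so the bound is proved for all smaller z
    and passes to the limit by density.\<close>
  have down: "2 * cdf \<mu> x - 1 \<le> H x" if "cdf \<mu> x > 0"
  proof (rule dense_le_bounded)
    show "-1 < 2 * cdf \<mu> x - 1" using that by simp
    fix w assume w: "-1 < w" "w < 2 * cdf \<mu> x - 1"
    define z where "z = (w + 1) / 2"
    have z: "0 \<le> z" "z < cdf \<mu> x" using w by (auto simp: z_def)
    then have "inv_cdf \<mu> z \<le> x"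
      unfolding inv_cdf_def by (intro cInf_lower bdd) auto
    then have "H (inv_cdf \<mu> z) \<le> H x" using H by (simp add: mono_def)
    moreover have "z < 1" using z cdf_bounded_prob[of x] by linarith
    ultimately have "2 * z - 1 \<le> H x" using eq z by auto
    moreover have "w = 2 * z - 1" by (simp add: z_def field_simps)
    ultimately show "w \<le> H x" by simp
  qed
  \<comment> \<open>If F x = 0 then \<open>up\<close> gives H x <= -1; if F x = 1 then
    \<open>down\<close> gives H x >= 1; in between both bounds apply and give equality.\<close>
  show "cdf \<mu> x = max 0 (min 1 ((1 + H x) / 2))"
    using up down cdf_nonneg[of x] cdf_bounded_prob[of x] by argo
next
  fix z :: real assume eq: "\<forall>x. cdf \<mu> x = max 0 (min 1 ((1 + H x) / 2))" and z: "z \<in> {0..<1}"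
  \<comment> \<open>For 0 <= z < 1 the clamped value exceeds z exactly when (1 + H x) / 2
    does.\<close>
  define S where "S = {x. H x > 2 * z - 1}"
  have S: "inv_cdf \<mu> z = Inf S"
    using z unfolding inv_cdf_def S_def by (intro arg_cong[of _ _ Inf]) (auto simp: eq max_def min_def field_simps)
  have ne: "S \<noteq> {}" using ends z by (auto simp: S_def intro!: exI[of _ xr])
  have monoH: "H s \<le> H t" if "s \<le> t" for s t using H that by (simp add: mono_def)
  have "xl \<le> xr" using monoH[of xr xl] ends by (cases "xl \<le> xr") auto
  then have "\<exists>p\<ge>xl. p \<le> xr \<and> H p = 2 * z - 1"
    using ends z by (intro IVT') (auto intro: continuous_on_subset[OF H(2)])
  then obtain p where p: "H p = 2 * z - 1" by auto
  have lb: "p \<le> s" if "s \<in> S" for s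
    using that monoH[of s p] p by (cases "p \<le> s") (auto simp: S_def)
  then have pI: "p \<le> Inf S" using ne by (intro cInf_greatest) auto
  \<comment> \<open>Otherwise H would take an intermediate value v > 2 z - 1 at some s <= Inf S.
    Such an s lies in S, so s = Inf S, although v < H (Inf S).\<close>
  have "\<not> H (Inf S) > 2 * z - 1"
  proof
    assume gt: "H (Inf S) > 2 * z - 1"
    define v where "v = (H (Inf S) + (2 * z - 1)) / 2"
    have v: "2 * z - 1 < v" "v < H (Inf S)" using gt by (auto simp: v_def)
    have "\<exists>s\<ge>p. s \<le> Inf S \<and> H s = v"
      using p v pI by (intro IVT') (auto intro: continuous_on_subset[OF H(2)])
    then obtain s where s: "s \<le> Inf S" "H s = v" by blast
    moreover have "Inf S \<le> s"
      using s v lb by (intro cInf_lower bdd_belowI[of _ p]) (auto simp: S_def)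
    ultimately show False using v by auto
  qed
  then show "H (inv_cdf \<mu> z) = 2 * z - 1"
    using monoH[OF pI] p S by simp
qed

section \<open>Measures with bounded, compactly supported density\<close>

lemma has_Linf_c_densityE:
  assumes "has_Linf_c_density M"
  obtains w C k where "w \<in> borel_measurable borel" "\<And>x. 0 \<le> w x" "0 \<le> C" "0 \<le> k"
    "AE x in lborel. w x \<le> C" "AE x in lborel. \<bar>x\<bar> > k \<longrightarrow> w x = 0"
    "M = density lborel (\<lambda>x. ennreal (w x))"
proof -
  from assms obtain w C K where w: "w \<in> borel_measurable borel" "\<And>x. 0 \<le> w x"
    "AE x in lborel. w x \<le> C" "compact K" "AE x in lborel. x \<notin> K \<longrightarrow> w x = 0"
    "M = density lborel (\<lambda>x. ennreal (w x))"
    unfolding has_Linf_c_density_def by blast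
  obtain k where k: "0 \<le> k" "\<And>x. x \<in> K \<Longrightarrow> \<bar>x\<bar> \<le> k"
    using compact_abs_bound[OF \<open>compact K\<close>] by metis
  show thesis
  proof (rule that[of w "max C 0" k])
    show "AE x in lborel. w x \<le> max C 0" using w(3) by eventually_elim simp
    show "AE x in lborel. \<bar>x\<bar> > k \<longrightarrow> w x = 0"
      using w(5) by eventually_elim (use k(2) in fastforce)
  qed (use w k in auto)
qed

locale Linf_c_measure =
  fixes \<omega> :: "real measure"
  assumes Linf_c: "has_Linf_c_density \<omega>"
begin

lemma sets_eq_borel [simp, measurable_cong]: "sets \<omega> = sets borel"
  using Linf_c by (auto simp: has_Linf_c_density_def)

lemma space_eq_UNIV [simp]: "space \<omega> = UNIV"
  using sets_eq_imp_space_eq[OF sets_eq_borel] by simp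

sublocale finite_borel_measure \<omega>
proof -
  obtain w C k where w: "w \<in> borel_measurable borel" "\<And>x. 0 \<le> w x" "0 \<le> C" "0 \<le> k"
    "AE x in lborel. w x \<le> C" "AE x in lborel. \<bar>x\<bar> > k \<longrightarrow> w x = 0"
    "\<omega> = density lborel (\<lambda>x. ennreal (w x))"
    by (rule has_Linf_c_densityE[OF Linf_c]) (rule that)
  have "emeasure \<omega> (space \<omega>) = (\<integral>\<^sup>+x. ennreal (w x) \<partial>lborel)"
    unfolding w(7) by (subst emeasure_density) (use w(1) in auto)
  also have "\<dots> \<le> (\<integral>\<^sup>+x. ennreal C * indicator {-k..k} x \<partial>lborel)"
  proof (rule nn_integral_mono_AE)
    show "AE x in lborel. ennreal (w x) \<le> ennreal C * indicator {-k..k} x"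
      using w(5,6) by eventually_elim (auto simp: indicator_def intro!: ennreal_leI)
  qed
  also have "\<dots> = ennreal C * emeasure lborel {-k..k}"
    by (rule nn_integral_cmult_indicator) simp
  also have "\<dots> < \<infinity>"
    using w(4) by (simp add: ennreal_mult_less_top)
  finally have "finite_measure \<omega>" by (intro finite_measureI) simp
  then show "finite_borel_measure \<omega>"
    by (rule finite_borel_measure.intro[OF _ finite_borel_measure_axioms.intro[OF sets_eq_borel]])
qed

text \<open>Absence of atoms: it neutralises the jump of \<open>sgn\<close> and lets closed and
  half-open intervals be exchanged.\<close>

lemma AE_neq: "AE y in \<omega>. y \<noteq> x"
proof -
  obtain w where w: "w \<in> borel_measurable borel" "\<omega> = density lborel (\<lambda>x. ennreal (w x))"
    using Linf_c by (auto simp: has_Linf_c_density_def)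
  have "AE y in lborel. 0 < ennreal (w y) \<longrightarrow> y \<noteq> x"
    using AE_lborel_singleton[of x] by eventually_elim simp
  then show ?thesis unfolding w(2) by (subst AE_density) (use w(1) in auto)
qed

lemma emeasure_singleton [simp]: "emeasure \<omega> {x} = 0"
  using AE_iff_measurable[of "{x}" \<omega> "\<lambda>y. y \<noteq> x"] AE_neq[of x] by auto

lemma AE_bounded: obtains k where "0 \<le> k" "AE y in \<omega>. \<bar>y\<bar> \<le> k"
proof -
  obtain w k where w: "w \<in> borel_measurable borel" "0 \<le> k"
    "AE x in lborel. \<bar>x\<bar> > k \<longrightarrow> w x = 0" "\<omega> = density lborel (\<lambda>x. ennreal (w x))"
    by (rule has_Linf_c_densityE[OF Linf_c]) (rule that)
  have "AE y in lborel. 0 < ennreal (w y) \<longrightarrow> \<bar>y\<bar> \<le> k"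
    using w(3) by eventually_elim auto
  then have "AE y in \<omega>. \<bar>y\<bar> \<le> k"
    unfolding w(4) by (subst AE_density) (use w(1) in auto)
  then show thesis using that w(2) by blast
qed

lemma cdf_at_ends: obtains k where "0 \<le> k" "cdf \<omega> (- k) = 0" "cdf \<omega> k = mass \<omega>"
proof -
  obtain k where k: "0 \<le> k" "AE y in \<omega>. \<bar>y\<bar> \<le> k" by (rule AE_bounded)
  \<comment> \<open>The bound on the support leaves only the point -k, which carries no
    mass.\<close>
  have "measure \<omega> {..- k} = measure \<omega> {}"
    using k(2) AE_neq[of "- k"] by (intro finite_measure_eq_AE, eventually_elim) auto
  moreover have "measure \<omega> {..k} = measure \<omega> UNIV"
    using k(2) by (intro finite_measure_eq_AE, eventually_elim) auto
  ultimately show thesis using that[of k] k(1) by (simp add: cdf_def2 mass_def)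
qed

text \<open>The bound is uniform over x in [-B, B], as needed for dominated convergence along a
  bounded sequence.\<close>

lemma AE_abs_dpsi_le:
  assumes "q \<ge> 1"
  obtains k where "\<And>x B. \<bar>x\<bar> \<le> B \<Longrightarrow> AE y in \<omega>. \<bar>dpsi q (x - y)\<bar> \<le> dpsi q (B + k)"
proof -
  obtain k where k: "0 \<le> k" "AE y in \<omega>. \<bar>y\<bar> \<le> k" by (rule AE_bounded)
  show thesis
  proof (rule that[of k])
    fix x B :: real assume "\<bar>x\<bar> \<le> B"
    then show "AE y in \<omega>. \<bar>dpsi q (x - y)\<bar> \<le> dpsi q (B + k)"
      using k(2) by (elim eventually_mono) (use assms in \<open>auto intro!: abs_dpsi_le\<close>)
  qed
qed

lemma integrable_dpsi:
  assumes "q \<ge> 1"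
  shows "integrable \<omega> (\<lambda>y. dpsi q (x - y))"
proof -
  obtain k where "\<And>x B. \<bar>x\<bar> \<le> B \<Longrightarrow> AE y in \<omega>. \<bar>dpsi q (x - y)\<bar> \<le> dpsi q (B + k)"
    using AE_abs_dpsi_le[OF assms] by metis
  from this[of x "\<bar>x\<bar>"] show ?thesis by (intro integrable_const_bound) auto
qed

section \<open>The convolution of psi' with the measure\<close>

abbreviation H :: "real \<Rightarrow> real \<Rightarrow> real" where
  "H q \<equiv> conv_fun (dpsi q) \<omega>"

lemma mono_H: "q \<ge> 1 \<Longrightarrow> mono (H q)"
  unfolding conv_fun_def by (intro monoI integral_mono integrable_dpsi dpsi_mono) auto

lemma strict_mono_H:
  assumes "q > 1" "mass \<omega> > 0"
  shows "strict_mono (H q)"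
proof (rule strict_monoI)
  fix x y :: real assume "x < y"
  moreover have "emeasure \<omega> UNIV \<noteq> 0" using assms(2) by (auto simp: mass_def measure_def)
  ultimately show "H q x < H q y"
    unfolding conv_fun_def using assms
    by (intro integral_less_AE_space integrable_dpsi) (auto intro!: dpsi_strict_mono)
qed

text \<open>Dominated convergence with a constant majorant. The integrand can fail to converge only
  at y = x, a null point; for q = 1 this is where the lack of atoms enters.\<close>

lemma continuous_H:
  assumes "q \<ge> 1"
  shows "continuous_on UNIV (H q)"
proof (intro continuous_at_imp_continuous_on ballI continuous_at_sequentiallyI)
  obtain k where k: "\<And>x B. \<bar>x\<bar> \<le> B \<Longrightarrow> AE y in \<omega>. \<bar>dpsi q (x - y)\<bar> \<le> dpsi q (B + k)"
    using AE_abs_dpsi_le[OF assms] by metis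
  fix x :: real and u :: "nat \<Rightarrow> real" assume u: "u \<longlonglongrightarrow> x"
  then obtain B where B: "\<And>n. \<bar>u n\<bar> \<le> B"
    using convergent_imp_Bseq[of u] by (auto simp: convergent_def Bseq_def)
  show "(\<lambda>n. H q (u n)) \<longlonglongrightarrow> H q x"
    unfolding conv_fun_def
  proof (rule integral_dominated_convergence[where w = "\<lambda>_. dpsi q (B + k)"])
    show "AE y in \<omega>. norm (dpsi q (u n - y)) \<le> dpsi q (B + k)" for n
      using k[OF B] by simp
    show "AE y in \<omega>. (\<lambda>n. dpsi q (u n - y)) \<longlonglongrightarrow> dpsi q (x - y)"
      using AE_neq[of x]
    proof eventually_elim
      case (elim y)
      then have "isCont (dpsi q) (x - y)" using assms by (intro isCont_dpsi) auto
      moreover have "(\<lambda>n. u n - y) \<longlonglongrightarrow> x - y" by (intro tendsto_intros u)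
      ultimately show ?case by (rule isCont_tendsto_compose)
    qed
  qed auto
qed

text \<open>Off the null point y = x, \<open>sgn (x - y)\<close> is twice the indicator of y <= x,
  minus 1.\<close>

lemma H_1: "H 1 x = 2 * cdf \<omega> x - mass \<omega>"
proof -
  have "H 1 x = (LINT y|\<omega>. 2 * indicator {..x} y - 1)"
    unfolding conv_fun_def dpsi_1
    by (intro integral_cong_AE) (use AE_neq[of x] in \<open>auto elim!: eventually_mono simp: indicator_def\<close>)
  also have "\<dots> = 2 * cdf \<omega> x - mass \<omega>"
    by (subst Bochner_Integration.integral_diff)
       (auto simp: cdf_def2 mass_def less_top[symmetric] intro!: integrable_real_indicator)
  finally show ?thesis .
qed

lemma H_unbounded:
  assumes "q > 1" "mass \<omega> > 0"
  shows "\<exists>x. H q x \<ge> b" "\<exists>x. H q x \<le> - b"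
proof -
  obtain k where k: "0 \<le> k" "AE y in \<omega>. \<bar>y\<bar> \<le> k" by (rule AE_bounded)
  \<comment> \<open>Chosen so that \<open>mass \<omega> * dpsi q c\<close> equals |b|. At x = k + c
    almost every y satisfies x - y >= c, which bounds the integral from below; -(k + c) is the
    mirror image.\<close>
  define c where "c = (\<bar>b\<bar> / (mass \<omega> * q)) powr (1 / (q - 1))"
  have "c \<ge> 0" by (simp add: c_def)
  have "dpsi q c = q * \<bar>c\<bar> powr (q - 1)"
    using \<open>c \<ge> 0\<close> by (auto simp: dpsi_def sgn_real_def)
  also have "\<bar>c\<bar> powr (q - 1) = \<bar>b\<bar> / (mass \<omega> * q)"
    using assms by (simp add: c_def powr_powr)
  finally have "mass \<omega> * dpsi q c = \<bar>b\<bar>" using assms by simp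
  then have c: "(LINT y|\<omega>. dpsi q c) = \<bar>b\<bar>" by (simp add: mass_def)
  have "(LINT y|\<omega>. dpsi q c) \<le> H q (k + c)"
    unfolding conv_fun_def using assms
    by (intro integral_mono_AE integrable_dpsi)
       (use k in \<open>auto elim!: eventually_mono intro!: dpsi_mono\<close>)
  then show "\<exists>x. H q x \<ge> b" using c by (intro exI[of _ "k + c"]) linarith
  have "H q (- (k + c)) \<le> (LINT y|\<omega>. dpsi q (- c))"
    unfolding conv_fun_def using assms
    by (intro integral_mono_AE integrable_dpsi)
       (use k in \<open>auto elim!: eventually_mono intro!: dpsi_mono\<close>)
  then have "H q (- (k + c)) \<le> - \<bar>b\<bar>" using c by (simp add: dpsi_minus)
  then show "\<exists>x. H q x \<le> - b" by (intro exI[of _ "- (k + c)"]) linarith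
qed

text \<open>The intermediate value theorem between a value at most -1 and a value at least 1. For q
  = 1 the extreme values of H are -m and m, with m the mass, so m >= 1 is what makes such values
  available.\<close>

lemma H_surj:
  assumes "q > 1 \<or> q = 1 \<and> mass \<omega> \<ge> 1" "mass \<omega> > 0" "\<bar>v\<bar> \<le> 1"
  shows "\<exists>x. H q x = v"
proof -
  have "\<exists>a b. H q a \<le> - 1 \<and> 1 \<le> H q b"
  proof (cases "q = 1")
    case True
    obtain k where "cdf \<omega> (- k) = 0" "cdf \<omega> k = mass \<omega>" by (rule cdf_at_ends)
    then have "H q (- k) \<le> - 1 \<and> 1 \<le> H q k" using True assms(1) by (simp add: H_1)
    then show ?thesis by blast
  next
    case False
    then have "q > 1" using assms(1) by auto
    then show ?thesis using H_unbounded[OF _ assms(2), of q 1] by metis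
  qed
  then obtain a b where "H q a \<le> - 1" "1 \<le> H q b" by blast
  with assms(3) have ab: "H q a \<le> v" "v \<le> H q b" by auto
  have q: "q \<ge> 1" using assms by auto
  \<comment> \<open>The points a and b come without an order. If b < a, monotonicity squeezes both
    values to v.\<close>
  show ?thesis
  proof (cases "a \<le> b")
    case True
    then show ?thesis
      using IVT'[of "H q" a v b] ab continuous_on_subset[OF continuous_H[OF q]] by blast
  next
    case False
    then have "H q b \<le> H q a" using mono_H[OF q] by (simp add: mono_def)
    then have "H q a = v" using ab by linarith
    then show ?thesis by blast
  qed
qed

section \<open>The inverse distribution function as a transport of Lebesgue measure\<close>

text \<open>Outside [0, m) the set in \<open>inv_cdf\<close> is empty or all of the line, so its
  \<open>Inf\<close> carries no information. Monotonicity on [0, m) supplies measurability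
  there.\<close>

lemma mono_on_inv_cdf: "mono_on {0..<mass \<omega>} (inv_cdf \<omega>)"
proof (rule mono_onI)
  fix s t assume st: "s \<in> {0..<mass \<omega>}" "t \<in> {0..<mass \<omega>}" "s \<le> t"
  obtain k where k: "cdf \<omega> (- k) = 0" "cdf \<omega> k = mass \<omega>" by (rule cdf_at_ends)
  have "- k \<le> x" if "cdf \<omega> x > s" for x
    using cdf_nondecreasing[of x "- k"] k st that by (cases "- k \<le> x") auto
  then have "bdd_below {x. cdf \<omega> x > s}" by (intro bdd_belowI[of _ "- k"]) auto
  moreover have "k \<in> {x. cdf \<omega> x > t}" using k st by simp
  ultimately show "inv_cdf \<omega> s \<le> inv_cdf \<omega> t"
    unfolding inv_cdf_def using st by (intro cInf_superset_mono) auto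
qed

lemma measurable_inv_cdf:
  "inv_cdf \<omega> \<in> measurable (restrict_space lborel {0..<mass \<omega>}) borel"
  using borel_measurable_mono_on_fnc[OF mono_on_inv_cdf]
  unfolding measurable_cong_sets[OF sets_restrict_space_cong[OF sets_lborel] refl] .

lemma inv_cdf_le:
  assumes "0 \<le> z" "z < cdf \<omega> x"
  shows "inv_cdf \<omega> z \<le> x"
proof -
  obtain k where k: "cdf \<omega> (- k) = 0" by (rule cdf_at_ends)
  have "- k \<le> x" if "cdf \<omega> x > z" for x
    using cdf_nondecreasing[of x "- k"] k assms that by (cases "- k \<le> x") auto
  then show ?thesis
    unfolding inv_cdf_def using assms by (intro cInf_lower bdd_belowI[of _ "- k"]) auto
qed

text \<open>By right continuity, cdf x < z persists up to some c > x, which forces the infimum to be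
  at least c. The inequality in the conclusion is not strict, and so this is the converse of
  \<open>inv_cdf_le\<close> up to one value of z.\<close>

lemma le_cdf_if_inv_cdf_le:
  assumes "z < mass \<omega>" "inv_cdf \<omega> z \<le> x"
  shows "z \<le> cdf \<omega> x"
proof (rule ccontr)
  assume "\<not> z \<le> cdf \<omega> x"
  moreover have "(cdf \<omega> \<longlongrightarrow> cdf \<omega> x) (at_right x)"
    using cdf_is_right_cont[of x] by (simp add: continuous_within)
  ultimately have "eventually (\<lambda>y. cdf \<omega> y < z) (at_right x)"
    by (intro order_tendstoD) auto
  then obtain b where b: "x < b" "\<And>y. x < y \<Longrightarrow> y < b \<Longrightarrow> cdf \<omega> y < z"
    by (auto simp: eventually_at_right_field)
  define c where "c = (x + b) / 2"
  have c: "x < c" "cdf \<omega> c < z" using b by (auto simp: c_def)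
  have lb: "c \<le> y" if "cdf \<omega> y > z" for y
    using cdf_nondecreasing[of y c] c that by (cases "c \<le> y") auto
  obtain k where k: "cdf \<omega> k = mass \<omega>" by (rule cdf_at_ends)
  have "c \<le> inv_cdf \<omega> z"
    unfolding inv_cdf_def
  proof (rule cInf_greatest)
    have "k \<in> {y. cdf \<omega> y > z}" using k assms(1) by simp
    then show "{y. cdf \<omega> y > z} \<noteq> {}" by blast
  qed (use lb in auto)
  then show False using c assms by simp
qed

text \<open>The set of z whose image is at most x lies between [0, F x) and [0, F x], with F the
  cdf, so its Lebesgue measure is F x. Equal distribution functions then identify the two
  measures.\<close>

lemma distr_inv_cdf: "distr (restrict_space lborel {0..<mass \<omega>}) borel (inv_cdf \<omega>) = \<omega>"
proof (rule cdf_unique')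
  let ?L = "restrict_space lborel {0..<mass \<omega>}"
  note m = measurable_inv_cdf
  have m0: "0 \<le> mass \<omega>" by (simp add: mass_def)
  have em: "emeasure (distr ?L borel (inv_cdf \<omega>)) {..x} = ennreal (cdf \<omega> x)" for x
  proof -
    let ?S = "{z \<in> {0..<mass \<omega>}. inv_cdf \<omega> z \<le> x}"
    have vs: "inv_cdf \<omega> -` {..x} \<inter> space ?L = ?S"
      by (auto simp: space_restrict_space)
    have "?S \<in> sets ?L"
      unfolding vs[symmetric] by (rule measurable_sets[OF m]) simp
    then have S: "?S \<in> sets lborel"
      by (subst (asm) sets_restrict_space_iff) simp_all
    have cm: "cdf \<omega> x \<le> mass \<omega>" using cdf_bounded[of x] by (simp add: mass_def)
    have "emeasure (distr ?L borel (inv_cdf \<omega>)) {..x} = emeasure ?L ?S"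
      unfolding vs[symmetric] by (rule emeasure_distr[OF m]) simp
    also have "\<dots> = emeasure lborel ?S"
      by (rule emeasure_restrict_space) auto
    also have "\<dots> = ennreal (cdf \<omega> x)"
    proof (rule antisym)
      have "emeasure lborel ?S \<le> emeasure lborel {0..cdf \<omega> x}"
        by (intro emeasure_mono) (auto intro!: le_cdf_if_inv_cdf_le)
      then show "emeasure lborel ?S \<le> ennreal (cdf \<omega> x)"
        using cdf_nonneg[of x] by simp
      have "emeasure lborel {0..<cdf \<omega> x} \<le> emeasure lborel ?S"
        using cm S by (intro emeasure_mono) (auto intro!: inv_cdf_le)
      then show "ennreal (cdf \<omega> x) \<le> emeasure lborel ?S"
        using cdf_nonneg[of x] by simp
    qed
    finally show ?thesis .
  qed
  show "cdf (distr ?L borel (inv_cdf \<omega>)) = cdf \<omega>"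
    using em by (intro ext) (simp add: cdf_def2[of "distr _ _ _"] measure_def cdf_nonneg)
  have "emeasure (distr ?L borel (inv_cdf \<omega>)) (space (distr ?L borel (inv_cdf \<omega>))) =
      emeasure lborel {0..<mass \<omega>}"
    by (simp add: emeasure_distr[OF m] space_restrict_space emeasure_restrict_space)
  then have "finite_measure (distr ?L borel (inv_cdf \<omega>))"
    using m0 by (intro finite_measureI) simp
  then show "finite_borel_measure (distr ?L borel (inv_cdf \<omega>))"
    by (rule finite_borel_measure.intro[OF _ finite_borel_measure_axioms.intro]) simp
  show "finite_borel_measure \<omega>" by (rule finite_borel_measure_axioms)
qed

text \<open>Change of variables along \<open>distr_inv_cdf\<close> for q different from 1; for q = 1
  the definition is already the formula of \<open>H_1\<close>.\<close>

lemma attraction_eq_H: "attraction q \<omega> \<mu> z = H q (inv_cdf \<mu> z)"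
proof (cases "q = 1")
  case True
  then show ?thesis by (simp add: attraction_def H_1)
next
  case False
  let ?L = "restrict_space lborel {0..<mass \<omega>}"
  note m = measurable_inv_cdf
  have "attraction q \<omega> \<mu> z = (LINT \<zeta>|?L. dpsi q (inv_cdf \<mu> z - inv_cdf \<omega> \<zeta>))"
    using False by (simp add: attraction_def set_lebesgue_integral_def integral_restrict_space)
  also have "\<dots> = (LINT y|distr ?L borel (inv_cdf \<omega>). dpsi q (inv_cdf \<mu> z - y))"
    using m by (subst integral_distr) auto
  finally show ?thesis by (simp add: distr_inv_cdf conv_fun_def)
qed

section \<open>The measure psi'' * omega\<close>

text \<open>Split at distance 1 from x. Near x the density is at most C and psi'' integrates to
  psi'(1) - psi'(-1) = 2 q; farther away psi'' is at most q (q - 1) and the density integrates to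
  the mass.\<close>

lemma nn_integral_ddpsi_bounded:
  assumes "q > 1" "q \<le> 2"
  obtains B where "0 \<le> B" "\<And>x. (\<integral>\<^sup>+y. ennreal (ddpsi q (x - y)) \<partial>\<omega>) \<le> ennreal B"
proof -
  obtain w C k where w: "w \<in> borel_measurable borel" "\<And>x. 0 \<le> w x" "0 \<le> C" "0 \<le> k"
    "AE x in lborel. w x \<le> C" "AE x in lborel. \<bar>x\<bar> > k \<longrightarrow> w x = 0"
    "\<omega> = density lborel (\<lambda>x. ennreal (w x))"
    by (rule has_Linf_c_densityE[OF Linf_c]) (rule that)
  note [measurable] = w(1)
  have mass_w: "(\<integral>\<^sup>+y. ennreal (w y) \<partial>lborel) = ennreal (mass \<omega>)"
  proof -
    have "(\<integral>\<^sup>+y. ennreal (w y) \<partial>lborel) = emeasure \<omega> UNIV"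
      unfolding w(7) by (subst emeasure_density) auto
    then show ?thesis by (simp add: mass_def emeasure_eq_measure)
  qed
  show thesis
  proof (rule that[of "C * (2 * q) + q * (q - 1) * mass \<omega>"])
    show "0 \<le> C * (2 * q) + q * (q - 1) * mass \<omega>" using assms w by (simp add: mass_def)
    fix x
    have "(\<integral>\<^sup>+y. ennreal (ddpsi q (x - y)) \<partial>\<omega>) =
        (\<integral>\<^sup>+y. ennreal (w y) * ennreal (ddpsi q (x - y)) \<partial>lborel)"
      unfolding w(7) by (subst nn_integral_density) auto
    also have "\<dots> \<le> (\<integral>\<^sup>+y. ennreal C * (ennreal (ddpsi q (y - x)) * indicator {x - 1..x + 1} y) +
        ennreal (q * (q - 1)) * ennreal (w y) \<partial>lborel)"
    proof (rule nn_integral_mono_AE)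
      show "AE y in lborel. ennreal (w y) * ennreal (ddpsi q (x - y)) \<le>
          ennreal C * (ennreal (ddpsi q (y - x)) * indicator {x - 1..x + 1} y) +
          ennreal (q * (q - 1)) * ennreal (w y)"
        using w(5)
      proof eventually_elim
        case (elim y)
        have sym: "ddpsi q (x - y) = ddpsi q (y - x)" by (simp add: ddpsi_def abs_minus_commute)
        show ?case
        proof (cases "y \<in> {x - 1..x + 1}")
          case True
          have "ennreal (w y) * ennreal (ddpsi q (x - y)) \<le> ennreal C * ennreal (ddpsi q (y - x))"
            unfolding sym using elim by (intro mult_right_mono ennreal_leI) auto
          then show ?thesis using True by (simp add: add_increasing2)
        next
          case False
          then have "ddpsi q (x - y) \<le> q * (q - 1)" using assms by (intro ddpsi_le) auto
          then have "ennreal (w y) * ennreal (ddpsi q (x - y)) \<le> ennreal (w y) * ennreal (q * (q - 1))"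
            by (intro mult_left_mono ennreal_leI) auto
          then show ?thesis using False by (simp add: mult.commute)
        qed
      qed
    qed
    also have "\<dots> = ennreal C * ennreal (dpsi q (x + 1 - x) - dpsi q (x - 1 - x)) +
        ennreal (q * (q - 1)) * ennreal (mass \<omega>)"
      using assms
      by (subst nn_integral_add; (subst nn_integral_cmult)?) (auto simp: nn_integral_ddpsi nn_integral_cmult mass_w)
    also have "dpsi q (x + 1 - x) - dpsi q (x - 1 - x) = 2 * q"
      by (simp add: dpsi_def)
    also have "ennreal C * ennreal (2 * q) + ennreal (q * (q - 1)) * ennreal (mass \<omega>) =
        ennreal (C * (2 * q) + q * (q - 1) * mass \<omega>)"
      using assms w by (simp add: ennreal_mult ennreal_plus mass_def)
    finally show "(\<integral>\<^sup>+y. ennreal (ddpsi q (x - y)) \<partial>\<omega>) \<le>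
        ennreal (C * (2 * q) + q * (q - 1) * mass \<omega>)" .
  qed
qed

text \<open>A Bochner integral defaults to 0 when the integrand is not integrable; the preceding
  bound rules this out.\<close>

lemma conv_fun_ddpsi_eq_nn_integral:
  assumes "q > 1" "q \<le> 2"
  shows "ennreal (conv_fun (ddpsi q) \<omega> x) = (\<integral>\<^sup>+y. ennreal (ddpsi q (x - y)) \<partial>\<omega>)"
proof -
  obtain B where B: "\<And>x. (\<integral>\<^sup>+y. ennreal (ddpsi q (x - y)) \<partial>\<omega>) \<le> ennreal B"
    using nn_integral_ddpsi_bounded[OF assms] by metis
  have "(\<integral>\<^sup>+y. ennreal (ddpsi q (x - y)) \<partial>\<omega>) < \<infinity>"
    using B[of x] by (rule le_less_trans) simp
  then have "integrable \<omega> (\<lambda>y. ddpsi q (x - y))"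
    using assms by (intro integrableI_nonneg) (auto simp: ddpsi_nonneg)
  then show ?thesis
    unfolding conv_fun_def using assms
    by (intro nn_integral_eq_integral[symmetric]) (auto simp: ddpsi_nonneg)
qed

lemma borel_measurable_conv_fun_ddpsi [measurable]: "conv_fun (ddpsi q) \<omega> \<in> borel_measurable borel"
  unfolding conv_fun_def by measurable

lemma conv_fun_ddpsi_nonneg: "q \<ge> 1 \<Longrightarrow> 0 \<le> conv_fun (ddpsi q) \<omega> x"
  unfolding conv_fun_def by (intro integral_nonneg_AE) (auto simp: ddpsi_nonneg)

text \<open>Only boundedness is recorded: for q > 1 the convolution generally has unbounded support,
  and compactness comes later from the truncation.\<close>

lemma ddpsi_conv_density:
  assumes "q \<in> {1..2}"
  obtains v B where "v \<in> borel_measurable borel" "\<And>x. 0 \<le> v x" "AE x in lborel. v x \<le> B"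
    "ddpsi_conv q \<omega> = density lborel (\<lambda>x. ennreal (v x))"
proof (cases "q = 1")
  case True
  obtain w C k where w: "w \<in> borel_measurable borel" "\<And>x. 0 \<le> w x" "0 \<le> C" "0 \<le> k"
    "AE x in lborel. w x \<le> C" "AE x in lborel. \<bar>x\<bar> > k \<longrightarrow> w x = 0"
    "\<omega> = density lborel (\<lambda>x. ennreal (w x))"
    by (rule has_Linf_c_densityE[OF Linf_c]) (rule that)
  note [measurable] = w(1)
  have "ddpsi_conv q \<omega> = scale_measure 2 \<omega>"
    unfolding True by (rule ddpsi_conv_1[OF finite_measure_axioms sets_eq_borel])
  also have "\<dots> = density lborel (\<lambda>x. ennreal (2 * w x))"
  proof (rule measure_eqI)
    fix A assume "A \<in> sets (scale_measure 2 \<omega>)"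
    then have [measurable]: "A \<in> sets borel" by simp
    show "emeasure (scale_measure 2 \<omega>) A = emeasure (density lborel (\<lambda>x. ennreal (2 * w x))) A"
      unfolding w(7) using w(2)
      by (simp add: emeasure_density nn_integral_cmult[symmetric] ennreal_mult mult.assoc)
  qed simp
  finally show thesis
    using w by (intro that[of "\<lambda>x. 2 * w x" "2 * C"]) auto
next
  case False
  then have q: "q > 1" "q \<le> 2" using assms by auto
  obtain B where B: "0 \<le> B" "\<And>x. (\<integral>\<^sup>+y. ennreal (ddpsi q (x - y)) \<partial>\<omega>) \<le> ennreal B"
    using nn_integral_ddpsi_bounded[OF q] by metis
  have "conv_fun (ddpsi q) \<omega> x \<le> B" for x
    using B(2)[of x] B(1) unfolding conv_fun_ddpsi_eq_nn_integral[OF q, symmetric] by simp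
  then show thesis
    using False q
    by (intro that[of "conv_fun (ddpsi q) \<omega>" B]) (auto simp: conv_fun_ddpsi_nonneg ddpsi_conv_def)
qed

lemma emeasure_ddpsi_conv_Icc:
  assumes "q \<in> {1..2}" "a \<le> b"
  shows "emeasure (ddpsi_conv q \<omega>) {a..b} = ennreal (H q b - H q a)"
proof (cases "q = 1")
  case True
  \<comment> \<open>The cdf difference measures the half-open interval; the added endpoint is a null
    set.\<close>
  have "{a..b} = {a<..b} \<union> {a}" using assms by auto
  moreover have "emeasure \<omega> ({a<..b} \<union> {a}) = emeasure \<omega> {a<..b}"
    by (rule emeasure_Un_null_set) (auto simp: null_sets_def)
  ultimately have "emeasure \<omega> {a..b} = emeasure \<omega> {a<..b}" by simp
  also have "\<dots> = ennreal (cdf \<omega> b - cdf \<omega> a)"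
    by (rule emeasure_Ioc[OF assms(2)])
  finally have "emeasure (scale_measure 2 \<omega>) {a..b} = ennreal 2 * ennreal (cdf \<omega> b - cdf \<omega> a)"
    by simp
  also have "\<dots> = ennreal (H q b - H q a)"
    unfolding True H_1 by (subst ennreal_mult'[symmetric]) (auto simp: algebra_simps)
  finally show ?thesis
    unfolding True ddpsi_conv_1[OF finite_measure_axioms sets_eq_borel] .
next
  case False
  then have q: "q > 1" "q \<le> 2" using assms by auto
  interpret pair_sigma_finite lborel \<omega> ..
  have "emeasure (ddpsi_conv q \<omega>) {a..b} =
      (\<integral>\<^sup>+x. ennreal (conv_fun (ddpsi q) \<omega> x) * indicator {a..b} x \<partial>lborel)"
    using q by (simp add: ddpsi_conv_def emeasure_density)
  also have "\<dots> = (\<integral>\<^sup>+x. \<integral>\<^sup>+y. ennreal (ddpsi q (x - y)) * indicator {a..b} x \<partial>\<omega> \<partial>lborel)"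
    by (simp add: conv_fun_ddpsi_eq_nn_integral[OF q] nn_integral_multc)
  also have "\<dots> = (\<integral>\<^sup>+y. \<integral>\<^sup>+x. ennreal (ddpsi q (x - y)) * indicator {a..b} x \<partial>lborel \<partial>\<omega>)"
    by (rule Fubini'[symmetric]) measurable
  also have "\<dots> = (\<integral>\<^sup>+y. ennreal (dpsi q (b - y) - dpsi q (a - y)) \<partial>\<omega>)"
    using nn_integral_ddpsi[OF q(1) assms(2)] by simp
  also have "\<dots> = ennreal (LINT y|\<omega>. dpsi q (b - y) - dpsi q (a - y))"
    using q assms
    by (intro nn_integral_eq_integral Bochner_Integration.integrable_diff integrable_dpsi)
       (auto intro!: dpsi_mono)
  also have "(LINT y|\<omega>. dpsi q (b - y) - dpsi q (a - y)) = H q b - H q a"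
    unfolding conv_fun_def using q by (intro Bochner_Integration.integral_diff integrable_dpsi) auto
  finally show ?thesis .
qed

section \<open>The truncated measure as the only steady state\<close>

text \<open>An indicator density, unlike a restricted space, keeps this a measure on the whole
  line.\<close>

definition truncation :: "real \<Rightarrow> real \<Rightarrow> real \<Rightarrow> real measure" where
  "truncation q xl xr = density (ddpsi_conv q \<omega>) (\<lambda>x. ennreal (1/2 * indicator {xl..xr} x))"

lemma has_Linf_c_density_truncation:
  assumes "q \<in> {1..2}"
  shows "has_Linf_c_density (truncation q xl xr)"
proof -
  obtain v B where v: "v \<in> borel_measurable borel" "\<And>x. 0 \<le> v x" "AE x in lborel. v x \<le> B"
    "ddpsi_conv q \<omega> = density lborel (\<lambda>x. ennreal (v x))"
    by (rule ddpsi_conv_density[OF assms]) (rule that)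
  note [measurable] = v(1)
  let ?w = "\<lambda>x. v x * (1/2 * indicator {xl..xr} x)"
  have "truncation q xl xr = density lborel (\<lambda>x. ennreal (?w x))"
    unfolding truncation_def v(4) ennreal_mult'[OF v(2)]
    by (rule density_density_eq) simp_all
  moreover have "AE x in lborel. ?w x \<le> B"
    using v(3)
  proof eventually_elim
    case (elim x)
    then show ?case using v(2)[of x] by (auto simp: indicator_def)
  qed
  moreover have "compact {xl..xr}" "AE x in lborel. x \<notin> {xl..xr} \<longrightarrow> ?w x = 0"
    by auto
  moreover have "?w \<in> borel_measurable borel" "\<forall>x. 0 \<le> ?w x" using v(2) by auto
  ultimately show ?thesis
    unfolding has_Linf_c_density_def by (intro bexI[of _ ?w] conjI exI) assumption+
qed

lemma emeasure_truncation:
  assumes "A \<in> sets borel"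
  shows "emeasure (truncation q xl xr) A =
    ennreal (1/2) * emeasure (ddpsi_conv q \<omega>) (A \<inter> {xl..xr})"
proof -
  have s: "sets (ddpsi_conv q \<omega>) = sets borel" by (simp add: ddpsi_conv_def)
  note [measurable_cong] = s
  note assms [measurable]
  have "emeasure (truncation q xl xr) A =
      (\<integral>\<^sup>+x. ennreal (1/2 * indicator {xl..xr} x) * indicator A x \<partial>ddpsi_conv q \<omega>)"
    unfolding truncation_def by (rule emeasure_density) (use s in measurable)
  also have "\<dots> = (\<integral>\<^sup>+x. ennreal (1/2) * indicator (A \<inter> {xl..xr}) x \<partial>ddpsi_conv q \<omega>)"
    by (intro nn_integral_cong) (auto simp: indicator_def)
  also have "\<dots> = ennreal (1/2) * emeasure (ddpsi_conv q \<omega>) (A \<inter> {xl..xr})"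
    by (rule nn_integral_cmult_indicator) (simp add: s assms)
  finally show ?thesis .
qed

context
  fixes q xl xr
  assumes q: "q \<in> {1..2}" and ends: "xl \<le> xr" "H q xl = - 1" "H q xr = 1"
begin

lemma real_distribution_truncation: "real_distribution (truncation q xl xr)"
proof -
  have s: "sets (truncation q xl xr) = sets borel" by (simp add: truncation_def ddpsi_conv_def)
  then have sp: "space (truncation q xl xr) = UNIV" using sets_eq_imp_space_eq by fastforce
  have "emeasure (truncation q xl xr) UNIV = ennreal (1/2) * ennreal 2"
    using q ends by (simp add: emeasure_truncation emeasure_ddpsi_conv_Icc)
  also have "\<dots> = 1" by (subst ennreal_mult[symmetric]) auto
  finally have "prob_space (truncation q xl xr)" using sp by (intro prob_spaceI) simp
  then show ?thesis using s
    by (intro real_distribution.intro real_distribution_axioms.intro)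
qed

lemma cdf_truncation: "cdf (truncation q xl xr) x = max 0 (min 1 ((1 + H q x) / 2))"
proof -
  have mono: "H q s \<le> H q t" if "s \<le> t" for s t
    using mono_H[of q] q that by (simp add: mono_def)
  \<comment> \<open>Used with b = x inside [xl, xr] and with b = xr to its right. Since H takes the
    value -1 at xl, the mass is (1 + H b) / 2.\<close>
  have emb: "emeasure (truncation q xl xr) {..x} = ennreal (1/2 * (H q b - H q xl))"
    if "{..x} \<inter> {xl..xr} = {xl..b}" "xl \<le> b" for b
    unfolding emeasure_truncation[OF borel_closed[OF closed_atMost]] that(1)
      emeasure_ddpsi_conv_Icc[OF q that(2)] by (rule ennreal_mult'[symmetric]) simp
  consider "x < xl" | "xl \<le> x" "x \<le> xr" | "xr < x" by linarith
  then have "emeasure (truncation q xl xr) {..x} = ennreal (max 0 (min 1 ((1 + H q x) / 2)))"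
  proof cases
    case 1
    then have "{..x} \<inter> {xl..xr} = {}" by auto
    then have "emeasure (truncation q xl xr) {..x} = 0" by (simp add: emeasure_truncation)
    moreover have "max 0 (min 1 ((1 + H q x) / 2)) = 0" using mono[of x xl] 1 ends by simp
    ultimately show ?thesis by simp
  next
    case 2
    then have "emeasure (truncation q xl xr) {..x} = ennreal (1/2 * (H q x - H q xl))"
      by (intro emb) auto
    moreover have "max 0 (min 1 ((1 + H q x) / 2)) = 1/2 * (H q x - H q xl)"
      using mono[of xl x] mono[of x xr] 2 ends by simp
    ultimately show ?thesis by (simp only:)
  next
    case 3
    then have "emeasure (truncation q xl xr) {..x} = ennreal (1/2 * (H q xr - H q xl))"
      using ends(1) by (intro emb) auto
    moreover have "max 0 (min 1 ((1 + H q x) / 2)) = 1/2 * (H q xr - H q xl)"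
      using mono[of xr x] 3 ends by simp
    ultimately show ?thesis by (simp only:)
  qed
  then show ?thesis
    unfolding cdf_def2 measure_def by (simp only: enn2real_ennreal[OF max.cobounded1])
qed

text \<open>By \<open>attraction_eq_H\<close> and \<open>cdf_eq_clamp_iff\<close>, a steady state is
  a candidate with the clamped cdf, which is the cdf of the truncation. The equivalence holds for
  every admissible pair of endpoints, so for q = 1, where they may fail to be unique, all choices
  give the same measure.\<close>

lemma steady_state_iff: "steady_state q 1 \<omega> \<mu> \<longleftrightarrow> \<mu> = truncation q xl xr"
proof -
  have key: "(\<forall>z\<in>{0..<1}. attraction q \<omega> \<nu> z = repulsion 1 \<nu> z) \<longleftrightarrow> cdf \<nu> = cdf (truncation q xl xr)"
    if "real_distribution \<nu>" "has_Linf_c_density \<nu>" for \<nu>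
  proof -
    interpret \<nu>: Linf_c_measure \<nu> by standard (rule that)
    \<comment> \<open>The compact support of the candidate itself supplies a point where its cdf
      vanishes.\<close>
    obtain k where "cdf \<nu> (- k) = 0" by (rule \<nu>.cdf_at_ends)
    from cdf_eq_clamp_iff[OF that(1) this mono_H continuous_H ends(2,3)] q
    show ?thesis
      by (simp add: attraction_eq_H repulsion_def fun_eq_iff cdf_truncation)
  qed
  show ?thesis
  proof
    assume st: "steady_state q 1 \<omega> \<mu>"
    then have L: "has_Linf_c_density \<mu>" by (simp add: steady_state_def)
    interpret \<mu>: Linf_c_measure \<mu> by standard (rule L)
    have "real_distribution \<mu>"
      using st by (intro real_distribution.intro real_distribution_axioms.intro)
        (simp_all add: steady_state_def)
    then show "\<mu> = truncation q xl xr"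
      using st key[OF _ L]
      by (intro cdf_unique real_distribution_truncation) (simp_all add: steady_state_def)
  next
    assume "\<mu> = truncation q xl xr"
    then show "steady_state q 1 \<omega> \<mu>"
      using key real_distribution_truncation has_Linf_c_density_truncation[OF q]
      by (simp add: steady_state_def real_distribution_def)
  qed
qed

end

lemma no_steady_state:
  assumes "mass \<omega> < 1"
  shows "\<not> steady_state 1 1 \<omega> \<mu>"
proof
  assume "steady_state 1 1 \<omega> \<mu>"
  then have "attraction 1 \<omega> \<mu> 0 = repulsion 1 \<mu> 0" by (simp add: steady_state_def)
  then have "2 * cdf \<omega> (inv_cdf \<mu> 0) - mass \<omega> = - 1"
    by (simp add: attraction_def repulsion_def)
  then show False using assms cdf_nonneg[of "inv_cdf \<mu> 0"] by simp
qed

end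

theorem proposition4p3:
  fixes q\<^sub>a q\<^sub>r :: real and \<omega> :: "real measure"
  assumes "q\<^sub>r = 1" and "q\<^sub>a \<in> {1..2}"
    and "has_Linf_c_density \<omega>" and "mass \<omega> > 0"
  shows "((q\<^sub>a > 1 \<or> (q\<^sub>a = 1 \<and> mass \<omega> \<ge> 1)) \<longrightarrow>
      (\<exists>xl x\<^sub>0 xr. xl < x\<^sub>0 \<and> x\<^sub>0 < xr \<and> conv_fun (dpsi q\<^sub>a) \<omega> x\<^sub>0 = 0 \<and>
          conv_fun (dpsi q\<^sub>a) \<omega> xl = -1 \<and> conv_fun (dpsi q\<^sub>a) \<omega> xr = 1) \<and>
      (q\<^sub>a > 1 \<longrightarrow> (\<exists>!x\<^sub>0. conv_fun (dpsi q\<^sub>a) \<omega> x\<^sub>0 = 0) \<and>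
          (\<exists>!xl. conv_fun (dpsi q\<^sub>a) \<omega> xl = -1) \<and> (\<exists>!xr. conv_fun (dpsi q\<^sub>a) \<omega> xr = 1)) \<and>
      (\<forall>xl x\<^sub>0 xr. xl < x\<^sub>0 \<and> x\<^sub>0 < xr \<and> conv_fun (dpsi q\<^sub>a) \<omega> x\<^sub>0 = 0 \<and>
          conv_fun (dpsi q\<^sub>a) \<omega> xl = -1 \<and> conv_fun (dpsi q\<^sub>a) \<omega> xr = 1 \<longrightarrow>
          (\<forall>\<mu>. steady_state q\<^sub>a q\<^sub>r \<omega> \<mu> \<longleftrightarrow>
            \<mu> = density (ddpsi_conv q\<^sub>a \<omega>) (\<lambda>x. ennreal (1/2 * indicator {xl..xr} x))))) \<and>
    ((q\<^sub>a = 1 \<and> mass \<omega> < 1) \<longrightarrow> \<not> (\<exists>\<mu>. steady_state q\<^sub>a q\<^sub>r \<omega> \<mu>))"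
proof (intro conjI impI)
  interpret Linf_c_measure \<omega> by standard (rule assms)
  {
    assume q: "q\<^sub>a > 1 \<or> (q\<^sub>a = 1 \<and> mass \<omega> \<ge> 1)"
    have surj: "\<exists>x. H q\<^sub>a x = v" if "\<bar>v\<bar> \<le> 1" for v
      using H_surj[OF q assms(4) that] .
    obtain xl x\<^sub>0 xr where x: "H q\<^sub>a xl = - 1" "H q\<^sub>a x\<^sub>0 = 0" "H q\<^sub>a xr = 1"
      using surj[of "- 1"] surj[of 0] surj[of 1] by auto
    \<comment> \<open>Monotonicity, even without strictness, orders points with different values;
      hence xl, x0 and xr come in the right order also for q = 1.\<close>
    have less: "s < t" if "H q\<^sub>a s < H q\<^sub>a t" for s t
      using mono_H[of q\<^sub>a] assms(2) that by (meson atLeastAtMost_iff linorder_not_le monoD)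
    show "\<exists>xl x\<^sub>0 xr. xl < x\<^sub>0 \<and> x\<^sub>0 < xr \<and> H q\<^sub>a x\<^sub>0 = 0 \<and> H q\<^sub>a xl = -1 \<and> H q\<^sub>a xr = 1"
      using x less[of xl x\<^sub>0] less[of x\<^sub>0 xr] by auto
    have ex1: "\<exists>!x. H q\<^sub>a x = v" if "q\<^sub>a > 1" "\<bar>v\<bar> \<le> 1" for v
      using surj[OF that(2)] strict_mono_H[OF that(1) assms(4)] by (metis strict_mono_eq)
    show "\<exists>!x. H q\<^sub>a x = 0" "\<exists>!x. H q\<^sub>a x = -1" "\<exists>!x. H q\<^sub>a x = 1" if "q\<^sub>a > 1"
      using ex1[OF that] by auto
    show "\<forall>xl x\<^sub>0 xr. xl < x\<^sub>0 \<and> x\<^sub>0 < xr \<and> H q\<^sub>a x\<^sub>0 = 0 \<and> H q\<^sub>a xl = -1 \<and> H q\<^sub>a xr = 1 \<longrightarrow>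
          (\<forall>\<mu>. steady_state q\<^sub>a q\<^sub>r \<omega> \<mu> \<longleftrightarrow>
            \<mu> = density (ddpsi_conv q\<^sub>a \<omega>) (\<lambda>x. ennreal (1/2 * indicator {xl..xr} x)))"
      unfolding truncation_def[symmetric] assms(1)
      by (intro allI impI steady_state_iff assms(2)) auto
  }
  assume "q\<^sub>a = 1 \<and> mass \<omega> < 1"
  then show "\<not> (\<exists>\<mu>. steady_state q\<^sub>a q\<^sub>r \<omega> \<mu>)"
    using no_steady_state assms(1) by auto
qed

end
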